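(* Let $G$ be a graph and let $e,f$ be two distinct edges of $G$. If $e$ and $f$ are neither both contained in a common $K_3$ of $G$ nor both contained in a common induced diamond of $G$, then $(e,f)\in\overline{\Theta}_G^*$.
   Context: Graphs are simple and undirected, with non-empty vertex set, not necessarily connected; $d$ is the shortest-path distance in $G$, with $d(u,v)=\infty$ if $u,v$ lie in different connected components (and $\infty+\infty=\infty$). For edges $e=\{a,b\}$ and $f=\{x,y\}$ the relation $\Theta_G$ on $E(G)$ is defined by $(e,f)\in\Theta_G$ iff $d(a,x)+d(b,y)\neq d(a,y)+d(b,x)$. The relation $\overline{\Theta}_G$ on $E(G)$ is defined by $(e,f)\in\overline{\Theta}_G$ iff $e=f$, or $e\neq f$ and $(e,f)\notin\Theta_G$. $R^*$ denotes the transitive closure of a reflexive symmetric relation $R$. $K_3$ is the triangle; the diamond is $K_{1,1,2}$ ($K_4$ minus one edge). "Contained" means being edges of the subgraph in question. *)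

theory Defs
  imports Main "HOL-Library.Extended_Nat"
begin

record 'a ugraph =
  verts :: "'a set"
  edges :: "'a set set"

text \<open>Simple undirected graphs: an edge is a two-element set of vertices. Graphs may be infinite.\<close>

definition simple_graph :: "'a ugraph \<Rightarrow> bool" where
  "simple_graph G \<longleftrightarrow>
     verts G \<noteq> {} \<and> (\<forall>e\<in>edges G. e \<subseteq> verts G \<and> card e = 2)"

definition is_path :: "'a ugraph \<Rightarrow> 'a list \<Rightarrow> bool" where
  "is_path G p \<longleftrightarrow>
     p \<noteq> [] \<and> distinct p \<and> set p \<subseteq> verts G \<and>
     (\<forall>i. Suc i < length p \<longrightarrow> {p ! i, p ! Suc i} \<in> edges G)"

text \<open>The length of a path is its number of edges. The infimum of the empty set is \<open>\<infinity>\<close>,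
  so vertices in different components have distance \<open>\<infinity>\<close>.\<close>

definition gdist :: "'a ugraph \<Rightarrow> 'a \<Rightarrow> 'a \<Rightarrow> enat" where
  "gdist G u v =
     (INF p \<in> {p. is_path G p \<and> hd p = u \<and> last p = v}. enat (length p - 1))"

definition Theta :: "'a ugraph \<Rightarrow> ('a set \<times> 'a set) set" where
  "Theta G = {(e, f). e \<in> edges G \<and> f \<in> edges G \<and>
     (\<exists>a b x y. e = {a, b} \<and> f = {x, y} \<and>
        gdist G a x + gdist G b y \<noteq> gdist G a y + gdist G b x)}"

text \<open>The existential quantifier in the definition of \<open>Theta\<close> is harmless: the condition does not
  depend on how the endpoints of the two edges are named.\<close>

lemma Theta_iff:
  assumes "{a, b} \<in> edges G" "{x, y} \<in> edges G"
  shows "({a, b}, {x, y}) \<in> Theta G \<longleftrightarrow>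
     gdist G a x + gdist G b y \<noteq> gdist G a y + gdist G b x"
  using assms by (auto simp: Theta_def doubleton_eq_iff add.commute)

definition Theta_bar :: "'a ugraph \<Rightarrow> ('a set \<times> 'a set) set" where
  "Theta_bar G = {(e, f). e \<in> edges G \<and> f \<in> edges G \<and>
     (e = f \<or> (e \<noteq> f \<and> (e, f) \<notin> Theta G))}"

definition subgraph :: "'a ugraph \<Rightarrow> 'a ugraph \<Rightarrow> bool" where
  "subgraph H G \<longleftrightarrow> simple_graph H \<and> verts H \<subseteq> verts G \<and> edges H \<subseteq> edges G"

definition induced_subgraph :: "'a ugraph \<Rightarrow> 'a ugraph \<Rightarrow> bool" where
  "induced_subgraph H G \<longleftrightarrow>
     subgraph H G \<and> edges H = {e \<in> edges G. e \<subseteq> verts H}"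

definition isomorphic :: "'a ugraph \<Rightarrow> 'b ugraph \<Rightarrow> bool" where
  "isomorphic G H \<longleftrightarrow>
     (\<exists>\<phi>. bij_betw \<phi> (verts G) (verts H) \<and>
        (\<forall>u\<in>verts G. \<forall>v\<in>verts G. {u, v} \<in> edges G \<longleftrightarrow> {\<phi> u, \<phi> v} \<in> edges H))"

definition K3 :: "nat ugraph" where
  "K3 = \<lparr>verts = {0, 1, 2}, edges = {{0, 1}, {0, 2}, {1, 2}}\<rparr>"

definition diamond :: "nat ugraph" where
  "diamond = \<lparr>verts = {0, 1, 2, 3}, edges = {{0, 1}, {0, 2}, {0, 3}, {1, 2}, {1, 3}}\<rparr>"

end

(* Two edges sharing a vertex and lying in no triangle are not in Theta, so all edges of a geodesic
   are chained together. For disjoint edges ab, xy in relation Theta, let k be the smallest of the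
   four distances, attained by a and x. If b-a-...-x and a-...-x-y are geodesics, a geodesic from a
   to x chains ab to xy. Otherwise three of the distances are k and the fourth is k + 1. For k = 1
   this is an induced diamond. For k >= 2 and d(b,y) = k + 1, let q precede x on a geodesic from b:
   qx is chained to xy, and ab is either not in Theta with qx or chained to it by the geodesic case. *)

theory Submission
  imports Defs
begin

section \<open>Paths and the distance they define\<close>

lemma is_path_Cons:
  assumes "is_path G p" "{u, hd p} \<in> edges G" "u \<in> verts G" "u \<notin> set p"
  shows "is_path G (u # p)"
  using assms by (auto simp: is_path_def nth_Cons hd_conv_nth split: nat.splits)

lemma is_path_drop:
  assumes "is_path G p" "i < length p"
  shows "is_path G (drop i p)"
  using assms set_drop_subset[of i p] by (auto simp: is_path_def)

lemma is_path_rev: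
  assumes "is_path G p"
  shows "is_path G (rev p)"
proof -
  have "{rev p ! i, rev p ! Suc i} \<in> edges G" if "Suc i < length p" for i
  proof -
    \<comment> \<open>The edge at position \<open>i\<close> of the reversed path is the edge at
      position \<open>?j\<close> of \<open>p\<close>, with its ends exchanged.\<close>
    let ?j = "length p - Suc (Suc i)"
    have "Suc ?j < length p" "Suc ?j = length p - Suc i"
      using that by auto
    then have "{p ! ?j, p ! (length p - Suc i)} \<in> edges G"
      using assms unfolding is_path_def by metis
    then show ?thesis
      using that by (simp add: rev_nth insert_commute)
  qed
  then show ?thesis
    using assms by (auto simp: is_path_def)
qed

lemma gdist_le:
  assumes "is_path G p" "hd p = u" "last p = v"
  shows "gdist G u v \<le> enat (length p - 1)"
  unfolding gdist_def using assms by (auto intro!: INF_lower)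

text \<open>A finite value rules out the infimum of the empty set, and a non-empty set of
  \<open>enat\<close> contains its infimum, so a geodesic exists.\<close>

lemma gdist_attained:
  assumes "gdist G u v = enat n"
  obtains p where "is_path G p" "hd p = u" "last p = v" "length p = Suc n"
proof -
  let ?A = "(\<lambda>p. enat (length p - 1)) ` {p. is_path G p \<and> hd p = u \<and> last p = v}"
  have I: "Inf ?A = enat n"
    using assms by (simp add: gdist_def)
  then have "?A \<noteq> {}"
    unfolding Inf_enat_def by (metis enat.distinct(1))
  then have "Inf ?A \<in> ?A"
    unfolding Inf_enat_def by (simp only: if_False) (metis (mono_tags, lifting) LeastI ex_in_conv)
  then obtain p where p: "is_path G p" "hd p = u" "last p = v" "length p - 1 = n"
    unfolding I by auto
  moreover have "p \<noteq> []"
    using p(1) by (simp add: is_path_def)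
  ultimately show thesis
    by (intro that[of p]) (auto simp: Suc_diff_1)
qed

lemma gdist_commute_le: "gdist G u v \<le> gdist G v u"
proof (cases "gdist G v u")
  case (enat n)
  then obtain p where "is_path G p" "hd p = v" "last p = u" "length p = Suc n"
    by (rule gdist_attained)
  then show ?thesis
    using gdist_le[OF is_path_rev, of G p u v] enat by (simp add: hd_rev last_rev)
qed simp

lemma gdist_commute: "gdist G u v = gdist G v u"
  by (simp add: antisym gdist_commute_le)

lemma gdist_self: "u \<in> verts G \<Longrightarrow> gdist G u u = 0"
  using gdist_le[of G "[u]" u u] by (simp add: is_path_def zero_enat_def[symmetric])

lemma gdist_eq_0D:
  assumes "gdist G u v = 0"
  shows "u = v"
proof -
  obtain p where "hd p = u" "last p = v" "length p = Suc 0"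
    using assms by (auto simp: zero_enat_def elim: gdist_attained)
  then show ?thesis
    by (cases p) auto
qed

section \<open>Distances across an edge and the triangle inequality\<close>

locale simple_ugraph =
  fixes G :: "'a ugraph"
  assumes simple: "simple_graph G"
begin

abbreviation d :: "'a \<Rightarrow> 'a \<Rightarrow> enat" where
  "d \<equiv> gdist G"

lemma edge_verts:
  assumes "{u, v} \<in> edges G"
  shows "u \<in> verts G" "v \<in> verts G" "u \<noteq> v"
  using assms simple by (force simp: simple_graph_def)+

lemma edgeE:
  assumes "e \<in> edges G"
  obtains u v where "e = {u, v}"
  using assms simple unfolding simple_graph_def card_2_iff by metis

text \<open>Paths have distinct vertices, so \<open>u\<close> cannot always be put in front of a
  geodesic from \<open>v\<close>. If it already lies on that geodesic, the part from
  \<open>u\<close> on is a path that is no longer.\<close>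

lemma gdist_step:
  assumes uv: "{u, v} \<in> edges G"
  shows "d u w \<le> d v w + 1"
proof (cases "d v w")
  case (enat n)
  then obtain p where p: "is_path G p" "hd p = v" "last p = w" "length p = Suc n"
    by (rule gdist_attained)
  show ?thesis
  proof (cases "u \<in> set p")
    case True
    then obtain i where i: "i < length p" "p ! i = u"
      by (auto simp: in_set_conv_nth)
    then have "d u w \<le> enat (length (drop i p) - 1)"
      using p by (intro gdist_le is_path_drop) (auto simp: hd_drop_conv_nth)
    also have "\<dots> \<le> enat (Suc n)"
      using p(4) by simp
    finally show ?thesis
      using enat by (simp add: one_enat_def)
  next
    case False
    then have "is_path G (u # p)"
      using p uv edge_verts[OF uv] by (intro is_path_Cons) auto
    moreover have "p \<noteq> []"
      using p(4) by auto
    ultimately show ?thesis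
      using gdist_le[of G "u # p" u w] p enat by (simp add: one_enat_def)
  qed
qed simp

text \<open>\<open>c\<close> is the second vertex of a geodesic: the tail bounds
  \<open>d c w\<close> from above, \<open>gdist_step\<close> from below.\<close>

lemma gdist_neighbour:
  assumes "d u w = enat (Suc n)"
  obtains c where "{u, c} \<in> edges G" "d c w = enat n"
proof -
  obtain p where p: "is_path G p" "hd p = u" "last p = w" "length p = Suc (Suc n)"
    using assms by (rule gdist_attained)
  then obtain c q where pq: "p = u # c # q"
    by (cases p; cases "tl p") auto
  have uc: "{u, c} \<in> edges G"
    using p(1) unfolding pq is_path_def by force
  have "is_path G (c # q)"
    using is_path_drop[OF p(1), of 1] pq by simp
  then have "d c w \<le> enat n"
    using gdist_le[of G "c # q" c w] p pq by simp
  moreover have "enat (Suc n) \<le> d c w + 1"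
    using gdist_step[OF uc, of w] assms by simp
  ultimately have "d c w = enat n"
    by (cases "d c w") (auto simp: one_enat_def)
  then show thesis
    using uc that by blast
qed

text \<open>Induction on \<open>d u v\<close>, moving \<open>u\<close> one step towards
  \<open>v\<close>, avoids joining two paths that may share vertices.\<close>

lemma gdist_triangle: "d u w \<le> d u v + d v w"
proof (cases "d u v")
  case (enat n)
  then show ?thesis
  proof (induction n arbitrary: u)
    case 0
    then show ?case
      using gdist_eq_0D[of G u v] by (simp add: zero_enat_def)
  next
    case (Suc n)
    then obtain c where c: "{u, c} \<in> edges G" "d c v = enat n"
      by (auto elim: gdist_neighbour)
    have "d u w \<le> d c w + 1"
      by (rule gdist_step[OF c(1)])
    also have "\<dots> \<le> (d c v + d v w) + 1"
      using Suc.IH[OF c(2)] by (rule add_right_mono)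
    also have "\<dots> = d u v + d v w"
      using c(2) Suc.prems by (cases "d v w") (auto simp: one_enat_def)
    finally show ?case .
  qed
qed simp

lemma gdist_edge:
  assumes "{u, v} \<in> edges G"
  shows "d u v = enat 1"
proof -
  have "d u v \<le> enat 1"
    using gdist_step[OF assms, of v] edge_verts[OF assms] by (simp add: gdist_self one_enat_def)
  moreover have "d u v \<noteq> 0"
    using gdist_eq_0D edge_verts(3)[OF assms] by metis
  ultimately show ?thesis
    by (cases "d u v") (auto simp: zero_enat_def le_Suc_eq)
qed

lemma gdist_1_iff: "d u v = enat 1 \<longleftrightarrow> {u, v} \<in> edges G"
proof
  assume "d u v = enat 1"
  then obtain c where "{u, c} \<in> edges G" "d c v = enat 0"
    by (metis One_nat_def gdist_neighbour)
  then show "{u, v} \<in> edges G"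
    using gdist_eq_0D[of G c v] by (simp add: zero_enat_def)
qed (rule gdist_edge)

lemma gdist_edge_nat:
  assumes "{u, v} \<in> edges G" "d u w = enat n"
  obtains m where "d v w = enat m" "m \<le> Suc n" "n \<le> Suc m"
proof -
  have "d v w \<le> d u w + 1" "d u w \<le> d v w + 1"
    using gdist_step assms(1) by (auto simp: insert_commute)
  then show thesis
    using that assms(2) by (cases "d v w") (auto simp: one_enat_def)
qed

section \<open>Chaining edges along geodesics\<close>

lemma Theta_barI:
  assumes "{a, b} \<in> edges G" "{x, y} \<in> edges G" "d a x + d b y = d a y + d b x"
  shows "({a, b}, {x, y}) \<in> Theta_bar G"
  using assms Theta_iff[OF assms(1,2)] by (auto simp: Theta_bar_def)

text \<open>Both sums are 2: \<open>d b a + d a y\<close> is 1 + 1 and \<open>d b y + d a a\<close>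
  is 2 + 0.\<close>

lemma Theta_bar_adjacent:
  assumes "{b, a} \<in> edges G" "{a, y} \<in> edges G" "d b y = enat 2"
  shows "({b, a}, {a, y}) \<in> Theta_bar G"
  using assms gdist_edge[of b a] gdist_edge[of a y] gdist_self[of a G] edge_verts[of b a]
  by (intro Theta_barI) (auto simp: zero_enat_def)

text \<open>The hypotheses say that b-a-...-x-y is a geodesic. Consecutive edges on it have their
  outer ends at distance 2, so the induction walks from \<open>{b, a}\<close> to the next edge
  \<open>{a, c}\<close>.\<close>

lemma Theta_bar_geodesic_ends:
  assumes "{b, a} \<in> edges G" "{x, y} \<in> edges G" "d a x = enat n" "d b y = enat (n + 2)"
  shows "({b, a}, {x, y}) \<in> (Theta_bar G)\<^sup>+"
  using assms
proof (induction n arbitrary: a b)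
  case 0
  then show ?case
    using gdist_eq_0D[of G a x] Theta_bar_adjacent[of b a y] by (auto simp: zero_enat_def)
next
  case (Suc n)
  obtain c where c: "{a, c} \<in> edges G" "d c x = enat n"
    using Suc.prems(3) by (rule gdist_neighbour)
  \<comment> \<open>Any smaller value would give a shortcut from \<open>b\<close> to
    \<open>y\<close>.\<close>
  have ay: "d a y = enat (n + 2)" and bc: "d b c = enat 2"
  proof -
    have "d b y \<le> d b c + d c y" "d c y \<le> d c x + d x y" "d b c \<le> d b a + d a c"
      "d b y \<le> d b a + d a y" "d a y \<le> d a c + d c y"
      by (rule gdist_triangle)+
    then show "d a y = enat (n + 2)" "d b c = enat 2"
      using c Suc.prems gdist_edge[of b a] gdist_edge[of a c] gdist_edge[of x y]
      by (cases "d a y"; cases "d b c"; cases "d c y"; force)+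
  qed
  have "({b, a}, {a, c}) \<in> Theta_bar G"
    using Theta_bar_adjacent[OF Suc.prems(1) c(1) bc] .
  moreover have "({a, c}, {x, y}) \<in> (Theta_bar G)\<^sup>+"
    using Suc.IH[OF _ Suc.prems(2) c(2) ay] c(1) by (simp add: insert_commute)
  ultimately show ?case
    by (rule trancl_into_trancl2)
qed

lemma gdist_two_apart:
  assumes "{q, x} \<in> edges G" "{x, y} \<in> edges G" "d a q = enat k" "d a y = enat (k + 2)"
  shows "d q y = enat 2"
proof -
  have "d a y \<le> d a q + d q y" "d q y \<le> d q x + d x y"
    by (rule gdist_triangle)+
  then show ?thesis
    using assms gdist_edge[of q x] gdist_edge[of x y] by (cases "d q y") auto
qed

text \<open>Here b-...-x and a-...-y are geodesics, but \<open>d b y\<close> is left open. With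
  \<open>q\<close> the vertex before \<open>x\<close> on a geodesic from \<open>a\<close>, the first
  geodesic leads to \<open>{q, x}\<close>, and q-x-y is a geodesic too.\<close>

lemma Theta_bar_geodesic_between:
  assumes ab: "{a, b} \<in> edges G" and xy: "{x, y} \<in> edges G"
    and "d a x = enat (Suc k)" "d b x = enat (k + 2)" "d a y = enat (k + 2)"
  shows "({a, b}, {x, y}) \<in> (Theta_bar G)\<^sup>+"
proof -
  obtain q where q: "{q, x} \<in> edges G" "d a q = enat k"
    using gdist_neighbour[of x a k] assms(3) by (metis gdist_commute insert_commute)
  have "({b, a}, {q, x}) \<in> (Theta_bar G)\<^sup>+"
    using ab q assms(4) by (intro Theta_bar_geodesic_ends) (auto simp: insert_commute)
  moreover have "({q, x}, {x, y}) \<in> Theta_bar G"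
    using q xy gdist_two_apart[OF q(1) xy q(2) assms(5)] by (intro Theta_bar_adjacent)
  ultimately show ?thesis
    by (simp add: insert_commute)
qed

text \<open>Distances of at least 2 put the vertex \<open>q\<close> before \<open>x\<close> on a
  geodesic from \<open>b\<close> at distance at least 1 from \<open>b\<close>, as
  \<open>Theta_bar_geodesic_between\<close> requires.\<close>

lemma Theta_bar_far:
  assumes ab: "{a, b} \<in> edges G" and xy: "{x, y} \<in> edges G"
    and "d a x = enat (k + 2)" "d b x = enat (k + 2)" "d b y = enat (k + 3)"
  shows "({a, b}, {x, y}) \<in> (Theta_bar G)\<^sup>+"
proof -
  obtain q where q: "{q, x} \<in> edges G" "d b q = enat (Suc k)"
    using gdist_neighbour[of x b "Suc k"] assms(4)
    by (metis add_2_eq_Suc' gdist_commute insert_commute)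
  obtain m where m: "d a q = enat m" "m \<le> k + 2"
    using gdist_edge_nat[of b a q "Suc k"] ab q(2) by (auto simp: insert_commute)
  have "d a x \<le> d a q + d q x"
    by (rule gdist_triangle)
  then have "k + 1 \<le> m"
    using m(1) assms(3) gdist_edge[OF q(1)] by simp
  then consider "m = Suc k" | "m = k + 2"
    using m(2) by linarith
  then have "({a, b}, {q, x}) \<in> (Theta_bar G)\<^sup>+"
  proof cases
    \<comment> \<open>Both sums for \<open>{a, b}\<close> and \<open>{q, x}\<close> equal 2k +
      3.\<close>
    case 1
    then have "({a, b}, {q, x}) \<in> Theta_bar G"
      using ab q m(1) assms by (intro Theta_barI) auto
    then show ?thesis
      by blast
  next
    \<comment> \<open>Now \<open>b\<close> and \<open>q\<close> are the nearest ends, and both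
      \<open>a\<close> and \<open>x\<close> are one step further away.\<close>
    case 2
    then have "({b, a}, {q, x}) \<in> (Theta_bar G)\<^sup>+"
      using ab q m(1) assms(4)
      by (intro Theta_bar_geodesic_between[of b a q x k]) (auto simp: insert_commute)
    then show ?thesis
      by (simp add: insert_commute)
  qed
  moreover have "({q, x}, {x, y}) \<in> Theta_bar G"
    using q xy gdist_two_apart[OF q(1) xy q(2)] assms(5)
    by (intro Theta_bar_adjacent) (auto simp: numeral_3_eq_3)
  ultimately show ?thesis
    by (rule trancl_into_trancl)
qed

section \<open>Recognising triangles and induced diamonds\<close>

definition common_triangle :: "'a set \<Rightarrow> 'a set \<Rightarrow> bool" where
  "common_triangle e f \<longleftrightarrow>
     (\<exists>H. subgraph H G \<and> isomorphic H K3 \<and> e \<in> edges H \<and> f \<in> edges H)"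

definition common_diamond :: "'a set \<Rightarrow> 'a set \<Rightarrow> bool" where
  "common_diamond e f \<longleftrightarrow>
     (\<exists>H. induced_subgraph H G \<and> isomorphic H diamond \<and> e \<in> edges H \<and> f \<in> edges H)"

lemma common_triangleI:
  assumes E: "{a, b} \<in> edges G" "{a, y} \<in> edges G" "{b, y} \<in> edges G"
  shows "common_triangle {a, b} {a, y}"
proof -
  let ?H = "\<lparr>verts = {a, b, y}, edges = {{a, b}, {a, y}, {b, y}}\<rparr>"
  let ?\<phi> = "\<lambda>v. if v = a then 0 else if v = b then 1 else (2::nat)"
  have ne: "a \<noteq> b" "a \<noteq> y" "b \<noteq> y"
    using E edge_verts(3) by blast+
  have "subgraph ?H G"
    using E edge_verts[OF E(1)] edge_verts[OF E(2)] ne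
    by (auto simp: subgraph_def simple_graph_def)
  moreover have "isomorphic ?H K3"
    unfolding isomorphic_def
  proof (intro exI[of _ ?\<phi>] conjI)
    show "bij_betw ?\<phi> (verts ?H) (verts K3)"
      using ne by (auto simp: bij_betw_def inj_on_def K3_def)
    show "\<forall>u\<in>verts ?H. \<forall>v\<in>verts ?H. {u, v} \<in> edges ?H \<longleftrightarrow> {?\<phi> u, ?\<phi> v} \<in> edges K3"
      using ne by (auto simp: K3_def doubleton_eq_iff)
  qed
  ultimately show ?thesis
    unfolding common_triangle_def by (intro exI[of _ ?H]) auto
qed

lemma common_diamondI:
  assumes E: "{a, b} \<in> edges G" "{x, y} \<in> edges G" "{a, x} \<in> edges G" "{a, y} \<in> edges G"
      "{b, x} \<in> edges G"
    and nby: "{b, y} \<notin> edges G" "b \<noteq> y"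
  shows "common_diamond {a, b} {x, y}"
proof -
  let ?V = "{a, b, x, y}"
  let ?H = "\<lparr>verts = ?V, edges = {e \<in> edges G. e \<subseteq> ?V}\<rparr>"
  \<comment> \<open>\<open>a\<close> and \<open>x\<close> become the vertices of degree 3, and the
    non-adjacent \<open>b\<close> and \<open>y\<close> become 2 and 3.\<close>
  let ?\<phi> = "\<lambda>v. if v = a then 0 else if v = x then 1 else if v = b then 2 else (3::nat)"
  have ne: "a \<noteq> b" "x \<noteq> y" "a \<noteq> x" "a \<noteq> y" "b \<noteq> x"
    using E edge_verts(3) by blast+
  \<comment> \<open>\<open>isomorphic\<close> also compares pairs with \<open>u = v\<close>, where
    \<open>{u, v}\<close> is a singleton.\<close>
  have loop: "{v} \<notin> edges G" for v
    using edge_verts(3)[of v v] by auto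
  have "induced_subgraph ?H G"
    using E edge_verts simple
    by (auto simp: induced_subgraph_def subgraph_def simple_graph_def)
  moreover have "isomorphic ?H diamond"
    unfolding isomorphic_def
  proof (intro exI[of _ ?\<phi>] conjI)
    show "bij_betw ?\<phi> (verts ?H) (verts diamond)"
      using ne nby(2) by (auto simp: bij_betw_def inj_on_def diamond_def)
    show "\<forall>u\<in>verts ?H. \<forall>v\<in>verts ?H. {u, v} \<in> edges ?H \<longleftrightarrow> {?\<phi> u, ?\<phi> v} \<in> edges diamond"
      using ne nby loop E by (auto simp: diamond_def doubleton_eq_iff insert_commute)
  qed
  ultimately show ?thesis
    unfolding common_diamond_def using E by (intro exI[of _ ?H]) auto
qed

section \<open>Edges with a common vertex and disjoint edges\<close>

text \<open>The path through \<open>a\<close> gives \<open>d b y\<close> at most 2; the value 0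
  contradicts \<open>b \<noteq> y\<close> and 1 would close a triangle.\<close>

lemma Theta_bar_adjacent_edges:
  assumes E: "{a, b} \<in> edges G" "{a, y} \<in> edges G" and "b \<noteq> y"
    and nt: "\<not> common_triangle {a, b} {a, y}"
  shows "({a, b}, {a, y}) \<in> Theta_bar G"
proof -
  have "d b y \<le> d b a + d a y"
    by (rule gdist_triangle)
  then obtain n where n: "d b y = enat n" "n \<le> 2"
    using gdist_edge[of b a] gdist_edge[of a y] E by (cases "d b y") (auto simp: insert_commute)
  moreover have "n \<noteq> 0"
    using n gdist_eq_0D[of G b y] \<open>b \<noteq> y\<close> by (auto simp: zero_enat_def)
  moreover have "n \<noteq> 1"
    using n gdist_1_iff[of b y] common_triangleI[OF E] nt by auto
  ultimately have "d b y = enat 2"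
    by (metis One_nat_def le_SucE le_zero_eq numeral_2_eq_2)
  then show ?thesis
    using Theta_bar_adjacent[of b a y] E by (simp add: insert_commute)
qed

text \<open>For \<open>k = 0\<close> the distances are exactly the adjacencies of an induced
  diamond; for larger \<open>k\<close> the edges are far enough apart for
  \<open>Theta_bar_far\<close>.\<close>

lemma Theta_bar_three_equal:
  assumes E: "{a, b} \<in> edges G" "{x, y} \<in> edges G"
    and D: "d a x = enat (Suc k)" "d a y = enat (Suc k)" "d b x = enat (Suc k)"
      "d b y = enat (k + 2)"
    and nd: "\<not> common_diamond {a, b} {x, y}"
  shows "({a, b}, {x, y}) \<in> (Theta_bar G)\<^sup>+"
proof (cases k)
  case 0
  have "b \<noteq> y"
    using D(4) gdist_self[of b G] edge_verts[OF E(1)] by (auto simp: zero_enat_def)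
  moreover have "{a, x} \<in> edges G" "{a, y} \<in> edges G" "{b, x} \<in> edges G" "{b, y} \<notin> edges G"
    using D 0 by (auto simp: gdist_1_iff[symmetric])
  ultimately show ?thesis
    using common_diamondI E nd by blast
next
  case (Suc m)
  then show ?thesis
    using E D by (intro Theta_bar_far[of a b x y m]) (auto simp: numeral_3_eq_3)
qed

lemma Theta_bar_disjoint_nearest:
  assumes E: "{a, b} \<in> edges G" "{x, y} \<in> edges G"
    and ax: "d a x = enat (Suc k)"
    and min: "enat (Suc k) \<le> d a y" "enat (Suc k) \<le> d b x" "enat (Suc k) \<le> d b y"
    and nd: "\<not> common_diamond {a, b} {x, y}"
  shows "({a, b}, {x, y}) \<in> (Theta_bar G)\<^sup>+"
proof (cases "({a, b}, {x, y}) \<in> Theta_bar G")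
  case False
  then have Th: "d a x + d b y \<noteq> d a y + d b x"
    using Theta_barI[OF E] by blast
  obtain p where p: "d a y = enat p" "p \<le> k + 2"
    using gdist_edge_nat[of x y a "Suc k"] E ax by (auto simp: gdist_commute)
  obtain q where q: "d b x = enat q" "q \<le> k + 2"
    using gdist_edge_nat[of a b x "Suc k"] E ax by (auto simp: gdist_commute)
  obtain r where r: "d b y = enat r" "r \<le> Suc p"
    using gdist_edge_nat[of a b y p] E p by auto
  have rq: "r \<le> Suc q"
    using gdist_edge_nat[of x y b q] E q r by (auto simp: gdist_commute)
  have sw: "{a, b} = {b, a}" "{x, y} = {y, x}"
    by (rule insert_commute)+
  \<comment> \<open>The unequal sums in \<open>Th\<close> fix \<open>r\<close> unless
    \<open>p\<close> and \<open>q\<close> are both \<open>k + 2\<close>. In the last two cases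
    below, renaming the ends of one edge moves the single larger distance to the place of
    \<open>d b y\<close>.\<close>
  have "p = Suc k \<or> p = k + 2" "q = Suc k \<or> q = k + 2" "Suc k \<le> r" "Suc k + r \<noteq> p + q"
    using min p q r Th ax by auto
  then consider "p = k + 2" "q = k + 2" | "p = Suc k" "q = Suc k" "r = k + 2"
    | "p = Suc k" "q = k + 2" "r = Suc k" | "p = k + 2" "q = Suc k" "r = Suc k"
    using r(2) rq by linarith
  then show ?thesis
  proof cases
    case 1
    then show ?thesis
      using Theta_bar_geodesic_between[OF E ax] p q by simp
  next
    case 2
    then show ?thesis
      using Theta_bar_three_equal[OF E ax] p q r nd by simp
  next
    case 3
    then show ?thesis
      using Theta_bar_three_equal[of a b y x k] E p q r ax nd by (simp add: sw)
  next
    case 4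
    then show ?thesis
      using Theta_bar_three_equal[of b a x y k] E p q r ax nd by (simp add: sw)
  qed
qed blast

lemma Theta_bar_disjoint_edges:
  assumes E: "{a, b} \<in> edges G" "{x, y} \<in> edges G"
    and disj: "{a, b} \<inter> {x, y} = {}"
    and nd: "\<not> common_diamond {a, b} {x, y}"
  shows "({a, b}, {x, y}) \<in> (Theta_bar G)\<^sup>+"
proof -
  \<comment> \<open>Renaming the ends of the edges permutes these four distances, so the minimum may
    be taken at the first ends \<open>u\<close> and \<open>v\<close>.\<close>
  define D where "D = {d a x, d a y, d b x, d b y}"
  have Min: "Min D \<in> D" "\<And>t. t \<in> D \<Longrightarrow> Min D \<le> t"
    by (rule Min_in Min_le; simp add: D_def)+
  then obtain u u' v v' where uv: "{a, b} = {u, u'}" "{x, y} = {v, v'}" "d u v = Min D"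
    "D = {d u v, d u v', d u' v, d u' v'}"
    unfolding D_def by (smt (verit) insert_commute insert_iff empty_iff)
  show ?thesis
  proof (cases "Min D")
    \<comment> \<open>The edges lie in different components, and both sums are \<infinity>.\<close>
    case infinity
    then have "d a x = \<infinity>" "d a y = \<infinity>" "d b x = \<infinity>" "d b y = \<infinity>"
      using Min(2) by (auto simp: D_def)
    then show ?thesis
      using Theta_barI[OF E] by auto
  next
    case (enat n)
    have "n \<noteq> 0"
      using uv disj enat gdist_eq_0D[of G u v] by (auto simp: zero_enat_def)
    then obtain k where "n = Suc k"
      by (cases n) auto
    moreover have "Min D \<le> d u v'" "Min D \<le> d u' v" "Min D \<le> d u' v'"
      using Min(2) uv(4) by blast+
    ultimately show ?thesis
      using Theta_bar_disjoint_nearest[of u u' v v' k] E uv(1-3) nd enat by simp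
  qed
qed

end

theorem lemma3p10:
  fixes G :: "'a ugraph" and e f :: "'a set"
  assumes "simple_graph G"
    and "e \<in> edges G" and "f \<in> edges G" and "e \<noteq> f"
    and "\<not> (\<exists>H. subgraph H G \<and> isomorphic H K3 \<and> e \<in> edges H \<and> f \<in> edges H)"
    and "\<not> (\<exists>H. induced_subgraph H G \<and> isomorphic H diamond \<and> e \<in> edges H \<and> f \<in> edges H)"
  shows "(e, f) \<in> (Theta_bar G)\<^sup>+"
proof -
  interpret simple_ugraph G
    by unfold_locales (rule assms(1))
  have nt: "\<not> common_triangle e f" and nd: "\<not> common_diamond e f"
    using assms(5,6) by (simp_all add: common_triangle_def common_diamond_def)
  show ?thesis
  proof (cases "e \<inter> f = {}")
    case True
    obtain a b x y where "e = {a, b}" "f = {x, y}"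
      using edgeE assms(2,3) by metis
    then show ?thesis
      using Theta_bar_disjoint_edges assms(2,3) True nd by blast
  next
    case False
    then obtain a where a: "a \<in> e" "a \<in> f"
      by blast
    obtain b where b: "e = {a, b}"
      using edgeE[OF assms(2)] a(1) by (metis insertE insert_commute singletonD)
    obtain y where y: "f = {a, y}"
      using edgeE[OF assms(3)] a(2) by (metis insertE insert_commute singletonD)
    have "(e, f) \<in> Theta_bar G"
      using Theta_bar_adjacent_edges[of a b y] assms(2-4) nt by (auto simp: b y)
    then show ?thesis
      by blast
  qed
qed

end
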